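(* Let $L$ be an infeasible linear pencil of size $m$ in $n$ variables (i.e. $S_L=\emptyset$). Then $$-1\in M_L^{(2^{\min\{m-1,n\}}-1)}.$$
   Context: $\mathbb{R}[X]=\mathbb{R}[X_1,\dots,X_n]$, and $\mathbb{R}[X]_k$ is the space of polynomials of degree at most $k$. A linear pencil of size $m$ in $n$ variables is a symmetric $m\times m$ matrix $L=A_0+\sum_{i=1}^n X_iA_i$ with $A_0,\dots,A_n$ real symmetric $m\times m$ matrices. $A^*$ denotes the transpose, and $A\succeq0$ means that $A$ is real symmetric positive semidefinite. $S_L=\{x\in\mathbb{R}^n\mid L(x)\succeq0\}$; $L$ is infeasible if $S_L=\emptyset$. For an integer $k\ge0$, the truncated quadratic module is $$M_L^{(k)}=\Big\{\sum_i p_i^2+\sum_j v_j^*Lv_j\ \Big|\ p_i\in\mathbb{R}[X]_k,\ v_j\in(\mathbb{R}[X]_k)^m\Big\}\subseteq\mathbb{R}[X]_{2k+1}$$ (all sums finite). *)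

theory Defs
  imports "HOL-Library.Poly_Mapping" "Jordan_Normal_Form.Matrix"
begin

text \<open>
  Real polynomials are finitely supported maps from monomials to coefficients, with the
  convolution product of \<^theory>\<open>HOL-Library.Poly_Mapping\<close>. The variables of \<open>\<real>[X]\<close> in \<open>n\<close>
  variables are numbered \<open>0, ..., n - 1\<close>, so that \<open>n = 0\<close> is allowed; points of \<open>\<real>\<^sup>n\<close> are
  elements of \<open>carrier_vec n\<close>.
\<close>

type_synonym monomial = "nat \<Rightarrow>\<^sub>0 nat"
type_synonym rpoly = "monomial \<Rightarrow>\<^sub>0 real"

definition pconst :: "real \<Rightarrow> rpoly" where
  "pconst c = Poly_Mapping.single 0 c"

definition pvar :: "nat \<Rightarrow> rpoly" where
  "pvar i = Poly_Mapping.single (Poly_Mapping.single i 1) 1"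

definition monomial_degree :: "monomial \<Rightarrow> nat" where
  "monomial_degree t = (\<Sum>i\<in>Poly_Mapping.keys t. Poly_Mapping.lookup t i)"

definition polys_deg_le :: "nat \<Rightarrow> nat \<Rightarrow> rpoly set" where
  "polys_deg_le n k = {p. \<forall>t\<in>Poly_Mapping.keys p. Poly_Mapping.keys t \<subseteq> {..<n} \<and> monomial_degree t \<le> k}"

definition peval :: "real vec \<Rightarrow> rpoly \<Rightarrow> real" where
  "peval x p = (\<Sum>t\<in>Poly_Mapping.keys p. Poly_Mapping.lookup p t * (\<Prod>i\<in>Poly_Mapping.keys t. (x $ i) ^ Poly_Mapping.lookup t i))"

definition linear_pencil :: "nat \<Rightarrow> nat \<Rightarrow> rpoly mat \<Rightarrow> bool" where
  "linear_pencil m n L \<longleftrightarrow>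
     (\<exists>A :: nat \<Rightarrow> real mat.
        (\<forall>i\<le>n. A i \<in> carrier_mat m m \<and> transpose_mat (A i) = A i) \<and>
        L = mat m m (\<lambda>(r, c). pconst (A 0 $$ (r, c))
                              + (\<Sum>i<n. pvar i * pconst (A (Suc i) $$ (r, c)))))"

definition psd :: "real mat \<Rightarrow> bool" where
  "psd A \<longleftrightarrow> square_mat A \<and> transpose_mat A = A \<and>
     (\<forall>v\<in>carrier_vec (dim_row A). v \<bullet> (A *\<^sub>v v) \<ge> 0)"

definition spectrahedron :: "nat \<Rightarrow> rpoly mat \<Rightarrow> real vec set" where
  "spectrahedron n L = {x \<in> carrier_vec n. psd (map_mat (peval x) L)}"

definition infeasible :: "nat \<Rightarrow> rpoly mat \<Rightarrow> bool" where
  "infeasible n L \<longleftrightarrow> spectrahedron n L = {}"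

definition truncated_quadratic_module :: "nat \<Rightarrow> nat \<Rightarrow> nat \<Rightarrow> rpoly mat \<Rightarrow> rpoly set" where
  "truncated_quadratic_module m n k L =
     {(\<Sum>p\<leftarrow>ps. p ^ 2) + (\<Sum>v\<leftarrow>vs. v \<bullet> (L *\<^sub>v v)) | ps vs.
        set ps \<subseteq> polys_deg_le n k \<and>
        (\<forall>v\<in>set vs. v \<in> carrier_vec m \<and> (\<forall>i<m. v $ i \<in> polys_deg_le n k))}"

end

theory Submission
  imports Defs "HOL-Analysis.Function_Topology"
begin

text \<open>
  A semidefinite matrix \<open>B\<close> with \<open>tr(B L) = -1\<close> gives a certificate of degree \<open>0\<close>: write \<open>B\<close> as a sum of
  matrices \<open>v v\<^sup>T\<close>. If the cone of the forms \<open>tr(B L) + c\<close> with \<open>c \<ge> 0\<close> were closed, separating it from \<open>-1\<close>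
  would show that an infeasible pencil always has such a \<open>B\<close>. If there is none, a compactness argument
  (\<open>feasible_or_dual_matrix\<close>) still yields a nonzero \<open>B\<close> with \<open>tr(B L) = 0\<close>, hence a real vector \<open>v \<noteq> 0\<close>
  such that \<open>v\<^sup>T L v\<close> and \<open>- v\<^sup>T L v\<close> both lie in the quadratic module (\<open>dual_matrix_dichotomy\<close>).

  For such a \<open>v\<close> all affine forms \<open>l\<^sub>j = v\<^sup>T L e\<^sub>j\<close> satisfy \<open>- l\<^sub>j\<^sup>2 \<in> M\<close> in degree \<open>1\<close>
  (\<open>qmodule_minus_row_square\<close>). If \<open>1\<close> is a linear combination of them, then \<open>-1 \<in> M\<close> in degree \<open>1\<close>.
  Otherwise, on the affine subspace where all \<open>l\<^sub>j\<close> vanish, \<open>v\<close> is in the kernel of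
  \<open>L\<close>, so that deleting a row and column \<open>i\<close> with \<open>v\<^sub>i \<noteq> 0\<close> does not affect semidefiniteness. The smaller
  pencil, in the variables that remain after solving \<open>l\<^sub>j = 0\<close>, is therefore infeasible, and by
  induction \<open>-1\<close> has a certificate of some degree \<open>k\<close> for it. Read in the original variables, this is a
  certificate of \<open>-1 + z\<close>, where \<open>z = \<Sum>\<^sub>j l\<^sub>j g\<^sub>j\<close> and the \<open>g\<^sub>j\<close> have degree at most \<open>2 k\<close>
  (\<open>qmodule_substitute\<close>). Since \<open>- z\<^sup>2\<close> is in the module, the identity
  \<open>-1 = 2 (-1 + z) + (1 - z)\<^sup>2 - z\<^sup>2\<close> removes \<open>z\<close> at the cost of passing from \<open>k\<close> to \<open>2 k + 1\<close>
  (\<open>qmodule_doubling\<close>). If all \<open>l\<^sub>j\<close> are zero, then \<open>z = 0\<close> and the degree stays \<open>k\<close>. Each step with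
  doubling thus lowers both the size and the number of variables, and size \<open>1\<close> or no variables allow
  degree \<open>0\<close>; this gives the exponent \<open>min (m - 1) n\<close>.
\<close>

section \<open>Quadratic forms\<close>

text \<open>
  Matrices are functions of two indices, and a finite set \<open>I\<close> selects the rows and columns that
  count. Passing to a principal submatrix then means shrinking \<open>I\<close>, without renumbering.
\<close>

definition bform :: "nat set \<Rightarrow> (nat \<Rightarrow> nat \<Rightarrow> 'a::comm_ring_1) \<Rightarrow> (nat \<Rightarrow> 'a) \<Rightarrow> (nat \<Rightarrow> 'a) \<Rightarrow> 'a"
  where "bform I B u v = (\<Sum>r\<in>I. \<Sum>c\<in>I. u r * v c * B r c)"

abbreviation qform :: "nat set \<Rightarrow> (nat \<Rightarrow> nat \<Rightarrow> 'a::comm_ring_1) \<Rightarrow> (nat \<Rightarrow> 'a) \<Rightarrow> 'a"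
  where "qform I B v \<equiv> bform I B v v"

lemma bform_commute:
  assumes "\<And>r c. r \<in> I \<Longrightarrow> c \<in> I \<Longrightarrow> B r c = B c r"
  shows "bform I B u v = bform I B v u"
proof -
  have "bform I B u v = (\<Sum>c\<in>I. \<Sum>r\<in>I. u r * v c * B r c)"
    unfolding bform_def by (rule sum.swap)
  also have "\<dots> = bform I B v u"
    unfolding bform_def by (intro sum.cong refl) (auto simp: assms mult_ac)
  finally show ?thesis .
qed

lemma qform_combination:
  assumes "\<And>r c. r \<in> I \<Longrightarrow> c \<in> I \<Longrightarrow> B r c = B c r"
  shows "qform I B (\<lambda>i. p * v i + q * w i)
    = p^2 * qform I B v + 2 * p * q * bform I B v w + q^2 * qform I B w"
proof -
  have "qform I B (\<lambda>i. p * v i + q * w i) =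
     p^2 * qform I B v + p * q * bform I B v w + p * q * bform I B w v + q^2 * qform I B w"
    unfolding bform_def sum_distrib_left sum.distrib[symmetric]
    by (intro sum.cong refl) (simp add: algebra_simps power2_eq_square)
  then show ?thesis
    using bform_commute[where B = B and u = w and v = v, OF assms] by (simp add: algebra_simps)
qed

lemma bform_sum_columns:
  "bform I B u v = (\<Sum>c\<in>I. v c * (\<Sum>r\<in>I. u r * B r c))"
  unfolding bform_def sum_distrib_left
  by (subst sum.swap) (simp add: mult_ac)

lemma qform_insert:
  assumes "finite I" "a \<notin> I"
    and "\<And>r c. r \<in> insert a I \<Longrightarrow> c \<in> insert a I \<Longrightarrow> B r c = B c r"
  shows "qform (insert a I) B v
    = (v a)^2 * B a a + 2 * v a * (\<Sum>r\<in>I. v r * B a r) + qform I B v"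
proof -
  have "(\<Sum>r\<in>I. v r * v a * B r a) = v a * (\<Sum>r\<in>I. v r * B a r)"
    unfolding sum_distrib_left by (intro sum.cong refl) (simp add: assms(3) mult_ac)
  moreover have "(\<Sum>r\<in>I. v a * v r * B a r) = v a * (\<Sum>r\<in>I. v r * B a r)"
    unfolding sum_distrib_left by (simp add: mult_ac)
  ultimately show ?thesis
    using assms(1,2) by (simp add: bform_def sum.distrib power2_eq_square algebra_simps)
qed

text \<open>
  Cholesky decomposition, one index at a time. If the diagonal entry at \<open>a\<close> vanishes, then so does
  the whole row, because a semidefinite form is nonnegative along every line
  \<open>x \<mapsto> x e\<^sub>a + e\<^sub>r\<close>. If it is positive, row and column \<open>a\<close> are cleared by subtracting a rank one
  matrix, and the value of the Schur complement at \<open>u\<close> is the minimum over \<open>x\<close> of the value of \<open>B\<close> at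
  \<open>u + x e\<^sub>a\<close>.
\<close>

lemma psd_sum_of_rank_one:
  fixes B :: "nat \<Rightarrow> nat \<Rightarrow> real"
  assumes "finite I"
    and "\<And>r c. r \<in> I \<Longrightarrow> c \<in> I \<Longrightarrow> B r c = B c r"
    and "\<And>v. 0 \<le> qform I B v"
  shows "\<exists>vs. \<forall>r\<in>I. \<forall>c\<in>I. B r c = (\<Sum>v\<leftarrow>vs. v r * v c)"
  using assms
proof (induction I arbitrary: B rule: finite_induct)
  case empty
  then show ?case by simp
next
  case (insert a I B)
  note qf = qform_insert[OF insert.hyps, of B, OF insert.prems(1)]
  have sym: "B r c = B c r" if "r \<in> I" "c \<in> I" for r c
    using insert.prems(1) that by blast
  have restrict: "qform I C (u(a := x)) = qform I C u" "(\<Sum>r\<in>I. (u(a := x)) r * B a r) = (\<Sum>r\<in>I. u r * B a r)"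
    for C :: "nat \<Rightarrow> nat \<Rightarrow> real" and u x
    using insert.hyps(2) unfolding bform_def by (auto intro!: sum.cong)
  have psd: "0 \<le> x^2 * B a a + 2 * x * (\<Sum>r\<in>I. u r * B a r) + qform I B u" for u x
    using insert.prems(2)[of "u(a := x)"] qf[of "u(a := x)"] restrict
    by (simp del: fun_upd_apply add: fun_upd_same)
  have "0 \<le> B a a"
    using psd[of 1 "\<lambda>_. 0"] by (simp add: bform_def)
  then consider "B a a = 0" | "B a a > 0" by linarith
  then show ?case
  proof cases
    case 1
    have row: "B a r = 0" if "r \<in> I" for r
    proof (rule ccontr)
      assume nz: "B a r \<noteq> 0"
      let ?e = "\<lambda>i. if i = r then 1 else 0 :: real"
      have s1: "(\<Sum>i\<in>I. ?e i * B a i) = B a r"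
        using that insert.hyps(1) by (simp add: if_distrib[of "\<lambda>x. x * _"] cong: if_cong)
      have "0 \<le> 2 * x * B a r + qform I B ?e" for x
        using psd[of x ?e] 1 s1 by simp
      from this[of "- (qform I B ?e + 1) / (2 * B a r)"] nz show False
        by (simp add: field_simps)
    qed
    have "0 \<le> qform I B v" for v
      using psd[of 0 v] by simp
    from insert.IH[of B, OF sym this]
    obtain vs where vs: "\<forall>r\<in>I. \<forall>c\<in>I. B r c = (\<Sum>v\<leftarrow>vs. v r * v c)"
      by blast
    have "B r c = (\<Sum>v\<leftarrow>map (\<lambda>v. v(a := 0)) vs. v r * v c)"
      if "r \<in> insert a I" "c \<in> insert a I" for r c
    proof (cases "r = a \<or> c = a")
      case True
      then have "B r c = 0"
        using that row 1 insert.prems(1)[OF that] by auto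
      moreover have "(\<Sum>v\<leftarrow>map (\<lambda>v. v(a := 0)) vs. v r * v c) = 0"
        using True by (induction vs) auto
      ultimately show ?thesis by simp
    next
      case False
      then show ?thesis using vs that by (auto simp: o_def)
    qed
    then show ?thesis by blast
  next
    case 2
    \<comment> \<open>Split off the rank one matrix that agrees with \<open>B\<close> in row and column \<open>a\<close>; what remains
      is the Schur complement.\<close>
    define w where "w r = B a r / sqrt (B a a)" for r
    define C where "C r c = B r c - w r * w c" for r c
    have ww: "w r * w c = B a r * B a c / B a a" for r c
      using 2 by (simp add: w_def)
    have symC: "C r c = C c r" if "r \<in> I" "c \<in> I" for r c
      using sym[OF that] by (simp add: C_def)
    have psdC: "0 \<le> qform I C u" for u
    proof -
      let ?s = "\<Sum>r\<in>I. u r * B a r"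
      have "qform I C u = qform I B u - (\<Sum>r\<in>I. \<Sum>c\<in>I. (u r * B a r) * (u c * B a c) / B a a)"
        unfolding bform_def C_def ww sum_subtractf[symmetric]
        by (intro sum.cong refl) (simp add: algebra_simps)
      also have "(\<Sum>r\<in>I. \<Sum>c\<in>I. (u r * B a r) * (u c * B a c) / B a a) = ?s^2 / B a a"
        by (simp add: power2_eq_square sum_product sum_divide_distrib)
      finally have "qform I C u = qform I B u - ?s^2 / B a a" .
      moreover have "(- ?s / B a a)^2 * B a a + 2 * (- ?s / B a a) * ?s = - (?s^2 / B a a)"
        using 2 by (simp add: power2_eq_square field_simps)
      ultimately show ?thesis
        using psd[of "- ?s / B a a" u] by linarith
    qed
    from insert.IH[of C, OF symC psdC]
    obtain vs where vs: "\<forall>r\<in>I. \<forall>c\<in>I. C r c = (\<Sum>v\<leftarrow>vs. v r * v c)"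
      by blast
    have "B r c = (\<Sum>v\<leftarrow>w # map (\<lambda>v. v(a := 0)) vs. v r * v c)"
      if "r \<in> insert a I" "c \<in> insert a I" for r c
    proof (cases "r = a \<or> c = a")
      case True
      have "(\<Sum>v\<leftarrow>map (\<lambda>v. v(a := 0)) vs. v r * v c) = 0"
        using True by (induction vs) auto
      moreover have "B r c = w r * w c"
        using True 2 insert.prems(1)[OF that] by (auto simp: ww)
      ultimately show ?thesis by simp
    next
      case False
      then have "C r c = (\<Sum>v\<leftarrow>vs. v r * v c)" using vs that by auto
      then show ?thesis using False by (simp add: C_def o_def)
    qed
    then show ?thesis by blast
  qed
qed

text \<open>
  The feasible set of the dual problem. A matrix is a function on \<open>nat \<times> nat\<close>, so that compactness
  comes from Tychonoff's theorem; the entries outside \<open>I \<times> I\<close> are set to \<open>0\<close>. The bound on the entries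
  places the set in a product of compact intervals.
\<close>

lemma compact_bounded_psd_matrices:
  fixes I :: "nat set"
  assumes "finite I"
  shows "compact {B :: nat \<times> nat \<Rightarrow> real.
    (\<forall>p. B p \<in> (if p \<in> I \<times> I then {-1..1} else {0})) \<and> (\<forall>r c. B (r, c) = B (c, r)) \<and>
    (\<forall>v. 0 \<le> qform I (\<lambda>r c. B (r, c)) v) \<and> (\<Sum>r\<in>I. B (r, r)) \<le> 1}"
    (is "compact ?D")
proof -
  let ?K = "\<lambda>p. if p \<in> I \<times> I then {-1..1} else {0 :: real}"
  have "compactin (product_topology (\<lambda>_. euclidean) UNIV) (PiE UNIV ?K)"
    unfolding compactin_PiE by simp
  then have box: "compact (PiE UNIV ?K)"
    by (simp add: euclidean_product_topology)
  have coord: "continuous_on UNIV (\<lambda>B :: nat \<times> nat \<Rightarrow> real. B p)" for p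
    by (rule continuous_on_product_coordinates)
  have "closed {B :: nat \<times> nat \<Rightarrow> real. (\<forall>r c. B (r, c) = B (c, r)) \<and>
    (\<forall>v. 0 \<le> qform I (\<lambda>r c. B (r, c)) v) \<and> (\<Sum>r\<in>I. B (r, r)) \<le> 1}"
    unfolding bform_def
    by (intro closed_Collect_conj closed_Collect_all closed_Collect_eq closed_Collect_le
        continuous_intros coord)
  from compact_Int_closed[OF box this] show ?thesis
    by (rule back_subst[of compact]) (auto simp: PiE_def Pi_def)
qed

section \<open>A theorem of the alternative\<close>

text \<open>
  Let \<open>\<phi>\<close> have least norm on the segment from \<open>\<phi>\<close> to \<open>\<psi>\<close>. Then the derivative of the squared norm at
  \<open>e = 0\<close>, which is \<open>2 (\<langle>\<phi>, \<psi>\<rangle> - |\<phi>|\<^sup>2)\<close>, cannot be negative.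
\<close>

lemma nearest_point_obtuse:
  fixes \<phi> \<psi> :: "nat \<Rightarrow> real"
  assumes "finite T"
    and "\<And>e. 0 < e \<Longrightarrow> e \<le> 1 \<Longrightarrow> (\<Sum>t\<in>T. (\<phi> t)^2) \<le> (\<Sum>t\<in>T. ((1 - e) * \<phi> t + e * \<psi> t)^2)"
  shows "(\<Sum>t\<in>T. (\<phi> t)^2) \<le> (\<Sum>t\<in>T. \<phi> t * \<psi> t)"
proof (rule ccontr)
  assume neg: "\<not> ?thesis"
  define d where "d = (\<Sum>t\<in>T. (\<phi> t)^2) - (\<Sum>t\<in>T. \<phi> t * \<psi> t)"
  define q where "q = (\<Sum>t\<in>T. (\<psi> t - \<phi> t)^2)"
  have "d > 0" "q \<ge> 0" using neg by (auto simp: d_def q_def sum_nonneg)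
  have expand: "(\<Sum>t\<in>T. ((1 - e) * \<phi> t + e * \<psi> t)^2) = (\<Sum>t\<in>T. (\<phi> t)^2) - 2 * e * d + e^2 * q" for e
    unfolding d_def q_def sum_subtractf[symmetric] sum_distrib_left sum.distrib[symmetric]
    by (intro sum.cong refl) (simp add: algebra_simps power2_eq_square)
  \<comment> \<open>A step so small that the linear gain \<open>2 e d\<close> outweighs the quadratic loss \<open>e\<^sup>2 q\<close>; the summand
    \<open>1\<close> covers \<open>q = 0\<close>.\<close>
  define e where "e = min 1 (d / (q + 1))"
  have e: "0 < e" "e \<le> 1" "e * (q + 1) \<le> d"
  proof -
    show "0 < e" "e \<le> 1" using \<open>d > 0\<close> \<open>q \<ge> 0\<close> by (auto simp: e_def)
    have "e * (q + 1) \<le> d / (q + 1) * (q + 1)"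
      using \<open>q \<ge> 0\<close> by (intro mult_right_mono) (auto simp: e_def)
    then show "e * (q + 1) \<le> d" using \<open>q \<ge> 0\<close> by simp
  qed
  have "2 * e * d \<le> e * (e * q)"
    using assms(2)[OF e(1,2)] unfolding expand by (simp add: power2_eq_square mult_ac)
  then have "2 * d \<le> e * q" using e(1) by (simp add: mult_ac)
  also have "e * q \<le> d" using e by (simp add: algebra_simps)
  finally show False using \<open>d > 0\<close> by simp
qed

text \<open>
  The set of the affine forms \<open>tr(B L) + (1 - tr B)\<close>, with \<open>B\<close> semidefinite of trace at most \<open>1\<close>, is
  compact and convex. If it misses \<open>0\<close>, its point of least norm defines a functional that is positive
  on it: at \<open>B = 0\<close> this says that the functional is positive at the form \<open>1\<close>, hence a positive multiple
  of the evaluation at a point \<open>x\<close>, and at the matrices \<open>v v\<^sup>T / |v|\<^sup>2\<close> it says that \<open>L(x)\<close> is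
  semidefinite. Here \<open>a r c t\<close> is the coefficient of the variable \<open>X\<^sub>t\<close> in the entry \<open>(r, c)\<close> of \<open>L\<close>, with
  \<open>X\<^sub>0 = 1\<close>.
\<close>

lemma feasible_or_dual_matrix:
  fixes a :: "nat \<Rightarrow> nat \<Rightarrow> nat \<Rightarrow> real"
  assumes "finite I" "finite T" "0 \<in> T"
  obtains (feasible) x where "x 0 = 1"
      "\<And>v. 0 \<le> qform I (\<lambda>r c. \<Sum>t\<in>T. a r c t * x t) v"
  | (dual) B where "\<And>r c. B r c = B c r" "\<And>v. 0 \<le> qform I B v" "(\<Sum>r\<in>I. B r r) \<le> 1"
      "\<And>t. t \<in> T \<Longrightarrow> (\<Sum>r\<in>I. \<Sum>c\<in>I. B r c * a r c t)
          + (1 - (\<Sum>r\<in>I. B r r)) * (if t = 0 then 1 else 0) = 0"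
proof -
  define D where "D = {B :: nat \<times> nat \<Rightarrow> real.
    (\<forall>p. B p \<in> (if p \<in> I \<times> I then {-1..1} else {0})) \<and> (\<forall>r c. B (r, c) = B (c, r)) \<and>
    (\<forall>v. 0 \<le> qform I (\<lambda>r c. B (r, c)) v) \<and> (\<Sum>r\<in>I. B (r, r)) \<le> 1}"
  define val where "val B t = (\<Sum>r\<in>I. \<Sum>c\<in>I. B (r, c) * a r c t)
      + (1 - (\<Sum>r\<in>I. B (r, r))) * (if t = 0 then 1 else 0)" for B t
  have "compact D"
    unfolding D_def by (rule compact_bounded_psd_matrices[OF assms(1)])
  have zero_D: "(\<lambda>_. 0) \<in> D"
    by (auto simp: D_def bform_def)
  have "continuous_on D (\<lambda>B. \<Sum>t\<in>T. (val B t)^2)"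
    unfolding val_def
    by (intro continuous_intros continuous_on_subset[OF continuous_on_product_coordinates]) auto
  with \<open>compact D\<close> zero_D obtain B where B: "B \<in> D"
    and min: "\<And>B'. B' \<in> D \<Longrightarrow> (\<Sum>t\<in>T. (val B t)^2) \<le> (\<Sum>t\<in>T. (val B' t)^2)"
    using continuous_attains_inf[of D] by blast
  have val_convex: "val (\<lambda>p. (1 - e) * B p + e * B' p) t = (1 - e) * val B t + e * val B' t" for e B' t
    unfolding val_def
    by (simp add: algebra_simps sum.distrib sum_distrib_left sum_subtractf)
  have D_convex: "(\<lambda>p. (1 - e) * B p + e * B' p) \<in> D" if "B' \<in> D" "0 < e" "e \<le> 1" for e B'
  proof -
    have qf: "qform I (\<lambda>r c. (1 - e) * B (r, c) + e * B' (r, c)) v =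
        (1 - e) * qform I (\<lambda>r c. B (r, c)) v + e * qform I (\<lambda>r c. B' (r, c)) v" for v
      unfolding bform_def by (simp add: algebra_simps sum.distrib sum_distrib_left sum_subtractf)
    have tr: "(\<Sum>r\<in>I. (1 - e) * B (r, r) + e * B' (r, r)) =
        (1 - e) * (\<Sum>r\<in>I. B (r, r)) + e * (\<Sum>r\<in>I. B' (r, r))"
      by (simp add: sum.distrib sum_distrib_left)
    have up: "(1 - e) * x + e * y \<le> 1" if "x \<le> 1" "y \<le> 1" for x y :: real
      using convex_bound_le[OF that, of "1 - e" e] \<open>0 < e\<close> \<open>e \<le> 1\<close> by simp
    have low: "- 1 \<le> (1 - e) * x + e * y" if "- 1 \<le> x" "- 1 \<le> y" for x y :: real
      using up[of "- x" "- y"] that by simp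
    have bd: "- 1 \<le> B (r, c)" "B (r, c) \<le> 1" "- 1 \<le> B' (r, c)" "B' (r, c) \<le> 1"
      if "r \<in> I" "c \<in> I" for r c
      using B \<open>B' \<in> D\<close> that unfolding D_def by (auto split: if_splits)
    have out: "B (r, c) = 0" "B' (r, c) = 0" if "\<not> (r \<in> I \<and> c \<in> I)" for r c
      using B \<open>B' \<in> D\<close> that unfolding D_def
      by (auto dest!: spec[where x = "(r, c)"] split: if_splits)
    show ?thesis
      using B \<open>B' \<in> D\<close> that(2,3) bd out unfolding D_def mem_Collect_eq qf tr
      by (auto intro!: up low add_nonneg_nonneg mult_nonneg_nonneg)
  qed
  have obtuse: "(\<Sum>t\<in>T. (val B t)^2) \<le> (\<Sum>t\<in>T. val B t * val B' t)" if "B' \<in> D" for B'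
    using min[OF D_convex[OF that]] unfolding val_convex
    by (rule nearest_point_obtuse[OF assms(2)])
  show ?thesis
  proof (cases "\<forall>t\<in>T. val B t = 0")
    case True
    show ?thesis
      using B True unfolding D_def val_def by (intro dual[of "\<lambda>r c. B (r, c)"]) auto
  next
    case False
    \<comment> \<open>The residual \<open>val B\<close> of the nearest point is a separating functional. It is positive at
      the constant form \<open>1 = val 0\<close>, so that it can be rescaled to a point.\<close>
    then have "0 < (\<Sum>t\<in>T. (val B t)^2)"
      using assms(2) by (meson sum_pos2 zero_le_power2 zero_less_power2)
    then have pos: "0 < (\<Sum>t\<in>T. val B t * val B' t)" if "B' \<in> D" for B'
      using obtuse[OF that] by linarith
    have v0: "0 < val B 0"
      using pos[OF zero_D] assms(2,3) by (simp add: val_def if_distrib[of "\<lambda>x. _ * x"] cong: if_cong)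
    have "0 \<le> qform I (\<lambda>r c. \<Sum>t\<in>T. a r c t * (val B t / val B 0)) v" for v
    proof (cases "\<forall>r\<in>I. v r = 0")
      case True
      then show ?thesis by (simp add: bform_def)
    next
      case False
      define s where "s = (\<Sum>r\<in>I. (v r)^2)"
      have s: "s > 0"
        using False assms(1) unfolding s_def by (meson sum_pos2 zero_le_power2 zero_less_power2)
      \<comment> \<open>The rank one matrix of \<open>v\<close>, scaled to trace \<open>1\<close> so that the summand \<open>1 - tr V\<close> drops out.\<close>
      define V where "V = (\<lambda>(r, c). if r \<in> I \<and> c \<in> I then v r * v c / s else 0)"
      have tr: "(\<Sum>r\<in>I. V (r, r)) = 1"
        using s by (simp add: V_def s_def power2_eq_square sum_divide_distrib[symmetric])
      have V_bound: "- 1 \<le> v r * v c / s \<and> v r * v c / s \<le> 1" if "r \<in> I" "c \<in> I" for r c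
      proof -
        have "(v r)^2 \<le> s" "(v c)^2 \<le> s"
          unfolding s_def using that assms(1) by (auto intro: member_le_sum)
        moreover have "0 \<le> (v r - v c)^2" "0 \<le> (v r + v c)^2" by simp_all
        ultimately show ?thesis
          using s by (simp add: field_simps power2_eq_square)
      qed
      have "qform I (\<lambda>r c. V (r, c)) u = (\<Sum>r\<in>I. u r * v r)^2 / s" for u
        unfolding bform_def V_def power2_eq_square sum_product sum_divide_distrib
        by (intro sum.cong refl) (simp add: mult_ac)
      then have "V \<in> D"
        using V_bound tr s unfolding D_def by (auto simp: V_def mult_ac)
      have "val V t = (\<Sum>r\<in>I. \<Sum>c\<in>I. v r * v c / s * a r c t)" for t
        unfolding val_def tr by (simp add: V_def)
      then have "(\<Sum>t\<in>T. val B t * val V t)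
          = (\<Sum>t\<in>T. \<Sum>r\<in>I. \<Sum>c\<in>I. v r * v c * a r c t * (val B t / val B 0) * (val B 0 / s))"
        using v0 by (simp add: sum_distrib_left mult_ac)
      also have "\<dots> = (\<Sum>r\<in>I. \<Sum>c\<in>I. \<Sum>t\<in>T. v r * v c * a r c t * (val B t / val B 0) * (val B 0 / s))"
        by (subst sum.swap, intro sum.cong refl sum.swap)
      also have "\<dots> = qform I (\<lambda>r c. \<Sum>t\<in>T. a r c t * (val B t / val B 0)) v * (val B 0 / s)"
        unfolding bform_def sum_distrib_left sum_distrib_right by (simp add: mult_ac)
      finally show ?thesis
        using pos[OF \<open>V \<in> D\<close>] v0 s by (simp add: zero_less_mult_iff zero_less_divide_iff)
    qed
    then show ?thesis
      using v0 by (intro feasible[of "\<lambda>t. val B t / val B 0"]) auto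
  qed
qed

section \<open>Degrees and constant polynomials\<close>

lemma monomial_degree_plus: "monomial_degree (s + t) = monomial_degree s + monomial_degree t"
proof -
  let ?K = "Poly_Mapping.keys s \<union> Poly_Mapping.keys t"
  have K: "monomial_degree u = (\<Sum>i\<in>?K. Poly_Mapping.lookup u i)"
    if "Poly_Mapping.keys u \<subseteq> ?K" for u
    unfolding monomial_degree_def using that
    by (intro sum.mono_neutral_left) (auto simp: in_keys_iff)
  show ?thesis
    using K[of s] K[of t] K[of "s + t"] keys_add[of s t]
    by (simp add: lookup_add sum.distrib)
qed

lemma polys_deg_le_mono: "p \<in> polys_deg_le n j \<Longrightarrow> j \<le> k \<Longrightarrow> p \<in> polys_deg_le n k"
  unfolding polys_deg_le_def by force

lemma polys_deg_le_0: "0 \<in> polys_deg_le n k"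
  by (simp add: polys_deg_le_def)

lemma polys_deg_le_add:
  "p \<in> polys_deg_le n k \<Longrightarrow> q \<in> polys_deg_le n k \<Longrightarrow> p + q \<in> polys_deg_le n k"
  unfolding polys_deg_le_def using keys_add[of p q] by blast

lemma polys_deg_le_mult:
  assumes "p \<in> polys_deg_le n j" "q \<in> polys_deg_le n k"
  shows "p * q \<in> polys_deg_le n (j + k)"
  unfolding polys_deg_le_def
proof (intro CollectI ballI)
  fix t assume "t \<in> Poly_Mapping.keys (p * q)"
  then obtain r s where t: "t = r + s" "r \<in> Poly_Mapping.keys p" "s \<in> Poly_Mapping.keys q"
    using keys_mult[of p q] by blast
  then have "Poly_Mapping.keys r \<subseteq> {..<n}" "monomial_degree r \<le> j"
    "Poly_Mapping.keys s \<subseteq> {..<n}" "monomial_degree s \<le> k"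
    using assms unfolding polys_deg_le_def by blast+
  then show "Poly_Mapping.keys t \<subseteq> {..<n} \<and> monomial_degree t \<le> j + k"
    using keys_add[of r s] unfolding t(1) monomial_degree_plus by (auto intro: add_mono)
qed

lemma pconst_in_polys_deg_le: "pconst c \<in> polys_deg_le n k"
  by (auto simp: polys_deg_le_def pconst_def monomial_degree_def)

lemma pvar_in_polys_deg_le: "i < n \<Longrightarrow> 1 \<le> k \<Longrightarrow> pvar i \<in> polys_deg_le n k"
  by (auto simp: polys_deg_le_def pvar_def monomial_degree_def split: if_splits)

lemma pconst_0 [simp]: "pconst 0 = 0"
  by (simp add: pconst_def)

lemma pconst_1 [simp]: "pconst 1 = 1"
  by (simp add: pconst_def)

lemma pconst_add: "pconst (c + d) = pconst c + pconst d"
  by (simp add: pconst_def single_add)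

lemma pconst_mult: "pconst (c * d) = pconst c * pconst d"
  by (simp add: pconst_def mult_single)

lemma pconst_uminus: "pconst (- c) = - pconst c"
  by (simp add: pconst_def single_uminus)

lemma pconst_sum: "pconst (\<Sum>i\<in>A. f i) = (\<Sum>i\<in>A. pconst (f i))"
  by (induction A rule: infinite_finite_induct) (auto simp: pconst_add)

lemma pconst_power: "pconst (c ^ j) = pconst c ^ j"
  by (induction j) (auto simp: pconst_mult)

lemma pconst_half: "2 * pconst (1 / 2) = 1"
proof -
  have "2 * pconst (1 / 2) = pconst (1 / 2) + pconst (1 / 2)" by simp
  also have "\<dots> = pconst (1 / 2 + 1 / 2)" by (simp only: pconst_add)
  also have "\<dots> = 1" by simp
  finally show ?thesis .
qed

lemma polys_deg_le_1: "1 \<in> polys_deg_le n k"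
  using pconst_in_polys_deg_le[of 1] by simp

lemma polys_deg_le_pconst_mult: "p \<in> polys_deg_le n k \<Longrightarrow> pconst c * p \<in> polys_deg_le n k"
  using polys_deg_le_mult[OF pconst_in_polys_deg_le[of c n 0], of p k] by simp

lemma polys_deg_le_uminus: "p \<in> polys_deg_le n k \<Longrightarrow> - p \<in> polys_deg_le n k"
  by (simp add: polys_deg_le_def)

lemma polys_deg_le_diff:
  "p \<in> polys_deg_le n k \<Longrightarrow> q \<in> polys_deg_le n k \<Longrightarrow> p - q \<in> polys_deg_le n k"
  using polys_deg_le_add[of p n k "- q"] polys_deg_le_uminus[of q] by simp

lemma polys_deg_le_sum:
  "(\<And>i. i \<in> A \<Longrightarrow> f i \<in> polys_deg_le n k) \<Longrightarrow> (\<Sum>i\<in>A. f i) \<in> polys_deg_le n k"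
  by (induction A rule: infinite_finite_induct) (auto simp: polys_deg_le_add polys_deg_le_0)

section \<open>Truncated quadratic modules\<close>

text \<open>
  The truncated quadratic module of the matrix with entries \<open>L r c\<close>, \<open>r, c \<in> I\<close>, generated one summand
  at a time so that membership can be analysed by rule induction.
\<close>

inductive_set qmodule :: "nat \<Rightarrow> nat set \<Rightarrow> (nat \<Rightarrow> nat \<Rightarrow> rpoly) \<Rightarrow> nat \<Rightarrow> rpoly set"
  for n I L k where
  zero: "0 \<in> qmodule n I L k"
| square: "p \<in> polys_deg_le n k \<Longrightarrow> q \<in> qmodule n I L k \<Longrightarrow> p ^ 2 + q \<in> qmodule n I L k"
| qform: "(\<And>i. v i \<in> polys_deg_le n k) \<Longrightarrow> q \<in> qmodule n I L k \<Longrightarrow>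
    qform I L v + q \<in> qmodule n I L k"

lemma qmodule_add: "p \<in> qmodule n I L k \<Longrightarrow> q \<in> qmodule n I L k \<Longrightarrow> p + q \<in> qmodule n I L k"
  by (induction rule: qmodule.induct) (auto intro: qmodule.intros simp: add.assoc)

lemma qmodule_square: "p \<in> polys_deg_le n k \<Longrightarrow> p ^ 2 \<in> qmodule n I L k"
  using qmodule.square[OF _ qmodule.zero, of p] by simp

lemma qmodule_qform: "(\<And>i. v i \<in> polys_deg_le n k) \<Longrightarrow> qform I L v \<in> qmodule n I L k"
  using qmodule.qform[OF _ qmodule.zero, of v] by simp

lemma qmodule_mono: "p \<in> qmodule n I L j \<Longrightarrow> j \<le> k \<Longrightarrow> p \<in> qmodule n I L k"
  by (induction rule: qmodule.induct) (auto intro: qmodule.intros polys_deg_le_mono)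

lemma qmodule_cong:
  assumes "p \<in> qmodule n I L k" "\<And>r c. r \<in> I \<Longrightarrow> c \<in> I \<Longrightarrow> L r c = L' r c"
  shows "p \<in> qmodule n I L' k"
  using assms(1)
proof (induction rule: qmodule.induct)
  case (qform v q)
  have "qform I L v = qform I L' v"
    unfolding bform_def by (intro sum.cong refl) (simp add: assms(2))
  then show ?case using qmodule.qform[of v n k q I L'] qform by simp
qed (auto intro: qmodule.intros)

lemma qmodule_sum_list: "(\<And>p. p \<in> set ps \<Longrightarrow> p \<in> qmodule n I L k) \<Longrightarrow> sum_list ps \<in> qmodule n I L k"
  by (induction ps) (auto intro: qmodule_add qmodule.zero)

text \<open>
  A square factor \<open>g\<^sup>2\<close> is absorbed by the \<open>p\<^sub>i\<close> and \<open>v\<^sub>j\<close>, whose degree grows by that of \<open>g\<close>.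
\<close>

lemma qmodule_mult_square:
  assumes "q \<in> qmodule n I L k" "g \<in> polys_deg_le n j"
  shows "g ^ 2 * q \<in> qmodule n I L (k + j)"
  using assms(1)
proof (induction rule: qmodule.induct)
  case zero
  then show ?case by (simp add: qmodule.zero)
next
  case (square p q)
  have "(p * g) ^ 2 + g ^ 2 * q \<in> qmodule n I L (k + j)"
    using square assms(2) by (intro qmodule.square polys_deg_le_mult)
  then show ?case by (simp add: power_mult_distrib algebra_simps)
next
  case (qform v q)
  have "qform I L (\<lambda>i. v i * g) + g ^ 2 * q \<in> qmodule n I L (k + j)"
    using qform assms(2) by (intro qmodule.qform polys_deg_le_mult)
  also have "qform I L (\<lambda>i. v i * g) = g ^ 2 * qform I L v"
    unfolding bform_def sum_distrib_left by (simp add: power2_eq_square mult_ac)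
  finally show ?case by (simp add: algebra_simps)
qed

lemma qmodule_scale:
  assumes "q \<in> qmodule n I L k" "0 \<le> c"
  shows "pconst c * q \<in> qmodule n I L k"
  using qmodule_mult_square[OF assms(1) pconst_in_polys_deg_le[of "sqrt c" n 0]] assms(2)
  by (simp add: pconst_power[symmetric])

lemma qmodule_minus_one:
  assumes "pconst c \<in> qmodule n I L k" "c < 0"
  shows "- 1 \<in> qmodule n I L k"
  using qmodule_scale[OF assms(1), of "- 1 / c"] assms(2)
  by (simp add: pconst_mult[symmetric] pconst_uminus)

text \<open>
  Induction based on \<open>- (u + s)\<^sup>2 = (u - s)\<^sup>2 - 2 u\<^sup>2 - 2 s\<^sup>2\<close>.
\<close>

lemma qmodule_minus_square_sum:
  assumes "finite J"
    and "\<And>j. j \<in> J \<Longrightarrow> u j \<in> polys_deg_le n k"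
    and "\<And>j. j \<in> J \<Longrightarrow> - ((u j) ^ 2) \<in> qmodule n I L k"
  shows "- ((\<Sum>j\<in>J. u j) ^ 2) \<in> qmodule n I L k"
  using assms
proof (induction J rule: finite_induct)
  case empty
  then show ?case by (simp add: qmodule.zero)
next
  case (insert j J)
  let ?s = "\<Sum>j\<in>J. u j"
  have "(u j - ?s) ^ 2 + (- ((u j) ^ 2) + - ((u j) ^ 2) + (- (?s ^ 2) + - (?s ^ 2))) \<in> qmodule n I L k"
    using insert by (intro qmodule_add qmodule_square polys_deg_le_diff polys_deg_le_sum) auto
  moreover have "(u j - ?s) ^ 2 + (- ((u j) ^ 2) + - ((u j) ^ 2) + (- (?s ^ 2) + - (?s ^ 2))) = - ((u j + ?s) ^ 2)"
    by (simp add: power2_eq_square algebra_simps)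
  ultimately show ?case using insert.hyps by simp
qed

text \<open>
  Up to the term \<open>p\<^sup>2 v\<^sup>T L v\<close>, whose negative lies in the module by assumption, the value of the pencil
  at \<open>p v + l\<^sub>j e\<^sub>j\<close>, where \<open>l\<^sub>j = v\<^sup>T L e\<^sub>j\<close>, is \<open>2 p l\<^sub>j\<^sup>2 + l\<^sub>j\<^sup>2 L\<^sub>j\<^sub>j\<close>, and \<open>p = - (1 + L\<^sub>j\<^sub>j) / 2\<close> turns this into \<open>- l\<^sub>j\<^sup>2\<close>.
\<close>

lemma qmodule_minus_row_square:
  assumes sym: "\<And>r c. r \<in> I \<Longrightarrow> c \<in> I \<Longrightarrow> L r c = L c r"
    and fin: "finite I"
    and deg: "\<And>r c. L r c \<in> polys_deg_le n 1"
    and v: "\<And>i. v i \<in> polys_deg_le n 0"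
    and neg: "- qform I L v \<in> qmodule n I L 0"
    and j: "j \<in> I"
  shows "- ((\<Sum>r\<in>I. v r * L r j) ^ 2) \<in> qmodule n I L 1"
proof -
  define l where "l = (\<Sum>r\<in>I. v r * L r j)"
  define e where "e i = (if i = j then 1 else 0 :: rpoly)" for i
  define p where "p = pconst (- 1 / 2) * (1 + L j j)"
  have l: "l \<in> polys_deg_le n 1"
    unfolding l_def using polys_deg_le_mult[OF v deg] by (intro polys_deg_le_sum) simp
  have p: "p \<in> polys_deg_le n 1"
    unfolding p_def by (intro polys_deg_le_pconst_mult polys_deg_le_add polys_deg_le_1 deg)
  have e: "e i \<in> polys_deg_le n 0" for i
    by (simp add: e_def polys_deg_le_0 polys_deg_le_1)
  have "p * v i + l * e i \<in> polys_deg_le n 1" for i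
    using polys_deg_le_mult[OF p v] polys_deg_le_mult[OF l e] by (intro polys_deg_le_add) simp_all
  then have "qform I L (\<lambda>i. p * v i + l * e i) + p ^ 2 * - qform I L v \<in> qmodule n I L 1"
    using qmodule_mult_square[OF neg p] by (intro qmodule_add qmodule_qform) simp_all
  moreover have "bform I L v e = l"
    unfolding bform_sum_columns l_def e_def using fin j
    by (simp add: if_distrib[of "\<lambda>x. x * _"] cong: if_cong)
  moreover have "qform I L e = L j j"
    unfolding bform_def e_def using fin j
    by (simp add: if_distrib[of "\<lambda>x. x * _"] if_distrib[of "\<lambda>x. _ * x"] cong: if_cong)
  moreover have "2 * p = - 1 - L j j"
  proof -
    have "2 * p = - ((2 * pconst (1 / 2)) * (1 + L j j))"
      by (simp add: p_def pconst_uminus algebra_simps)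
    then show ?thesis by (simp only: pconst_half) simp
  qed
  moreover have "2 * p * l * l + l ^ 2 * L j j = - (l ^ 2)" if "2 * p = - 1 - L j j"
    unfolding that by (simp add: power2_eq_square algebra_simps)
  moreover have "qform I L (\<lambda>i. p * v i + l * e i)
      = p ^ 2 * qform I L v + 2 * p * l * bform I L v e + l ^ 2 * qform I L e"
    by (rule qform_combination) (rule sym)
  ultimately show ?thesis
    by (simp add: l_def[symmetric])
qed

section \<open>Affine forms and elimination of variables\<close>

text \<open>
  An affine form is given by its coefficients, with the constant term at index \<open>0\<close> and the coefficient
  of the variable \<open>pvar i\<close> at index \<open>i + 1\<close>.
\<close>

definition form :: "nat \<Rightarrow> (nat \<Rightarrow> real) \<Rightarrow> rpoly" where
  "form n f = (\<Sum>t\<le>n. pconst (f t) * (if t = 0 then 1 else pvar (t - 1)))"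

lemma form_in_polys_deg_le: "form n f \<in> polys_deg_le n 1"
  unfolding form_def
proof (intro polys_deg_le_sum polys_deg_le_pconst_mult)
  fix t assume "t \<in> {..n}"
  then show "(if t = 0 then 1 else pvar (t - 1)) \<in> polys_deg_le n 1"
    using pvar_in_polys_deg_le[of "t - 1" n 1] polys_deg_le_1[of n 1] by auto
qed

lemma form_add: "form n (\<lambda>t. f t + g t) = form n f + form n g"
  by (simp add: form_def pconst_add sum.distrib algebra_simps)

lemma form_mult: "form n (\<lambda>t. c * f t) = pconst c * form n f"
  by (simp add: form_def pconst_mult sum_distrib_left mult_ac)

lemma form_sum: "form n (\<lambda>t. \<Sum>j\<in>J. f j t) = (\<Sum>j\<in>J. form n (f j))"
  unfolding form_def pconst_sum sum_distrib_right by (rule sum.swap)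

lemma form_combination: "form n (\<lambda>t. \<Sum>j\<in>J. c j * f j t) = (\<Sum>j\<in>J. pconst (c j) * form n (f j))"
  by (simp add: form_sum form_mult)

lemma form_constant:
  assumes "\<And>t. t \<noteq> 0 \<Longrightarrow> f t = 0"
  shows "form n f = pconst (f 0)"
proof -
  have "form n f = (\<Sum>t\<le>n. if t = 0 then pconst (f 0) else 0)"
    unfolding form_def by (intro sum.cong refl) (auto simp: assms)
  then show ?thesis by simp
qed

definition supported :: "nat set \<Rightarrow> (nat \<Rightarrow> real) \<Rightarrow> bool" where
  "supported S f \<longleftrightarrow> (\<forall>t. t \<notin> insert 0 S \<longrightarrow> f t = 0)"

text \<open>
  Substitutes for each variable \<open>X\<^sub>t\<close>, including \<open>X\<^sub>0 = 1\<close>, the affine form with coefficients \<open>s t\<close>.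
\<close>

definition substitute :: "nat \<Rightarrow> (nat \<Rightarrow> nat \<Rightarrow> real) \<Rightarrow> (nat \<Rightarrow> real) \<Rightarrow> nat \<Rightarrow> real" where
  "substitute n s f = (\<lambda>u. \<Sum>t\<le>n. f t * s t u)"

lemma eval_substitute:
  "(\<Sum>u\<le>n. substitute n s f u * x u) = (\<Sum>t\<le>n. f t * (\<Sum>u\<le>n. s t u * x u))"
  unfolding substitute_def sum_distrib_left sum_distrib_right
  by (subst sum.swap) (simp add: mult_ac)

text \<open>
  The substitution \<open>s\<close> solves the linear system \<open>l j = 0\<close>, \<open>j \<in> J\<close>, for the variables in \<open>S - S'\<close>: it
  kills the equations and changes no form modulo their span. The last clause says that a nonzero
  system determines at least one variable.
\<close>

definition eliminates ::
  "nat \<Rightarrow> nat set \<Rightarrow> nat set \<Rightarrow> (nat \<Rightarrow> nat \<Rightarrow> real) \<Rightarrow> nat set \<Rightarrow> (nat \<Rightarrow> nat \<Rightarrow> real) \<Rightarrow> bool" where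
  "eliminates n J S l S' s \<longleftrightarrow>
     S' \<subseteq> S \<and> (\<forall>u. s 0 u = (if u = 0 then 1 else 0)) \<and>
     (\<forall>f. supported S f \<longrightarrow> supported S' (substitute n s f) \<and>
        (\<exists>h. \<forall>u. f u = substitute n s f u + (\<Sum>j\<in>J. h j * l j u))) \<and>
     (\<forall>j\<in>J. \<forall>u. substitute n s (l j) u = 0) \<and>
     (S' = S \<longrightarrow> (\<forall>j\<in>J. \<forall>u. l j u = 0))"

text \<open>
  Gaussian elimination, one equation at a time. The equation \<open>l j\<close>, reduced by the earlier ones, is
  zero, or a nonzero constant (then \<open>1\<close> lies in the span of the equations), or it can be solved for a
  variable \<open>p\<close>.
\<close>

lemma elimination:
  assumes "finite J" "S \<subseteq> {1..n}" "\<And>j. j \<in> J \<Longrightarrow> supported S (l j)"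
  shows "(\<exists>c. \<forall>u. (\<Sum>j\<in>J. c j * l j u) = (if u = 0 then 1 else 0)) \<or> (\<exists>S' s. eliminates n J S l S' s)"
  using assms
proof (induction J rule: finite_induct)
  case empty
  define s where "s t u = (if t = u then 1 else 0 :: real)" for t u :: nat
  have sub: "substitute n s f = f" if "supported S f" for f
  proof
    fix u
    show "substitute n s f u = f u"
    proof (cases "u \<le> n")
      case True
      then show ?thesis by (simp add: substitute_def s_def if_distrib[of "\<lambda>x. _ * x"] cong: if_cong)
    next
      case False
      then have "u \<notin> insert 0 S" using \<open>S \<subseteq> {1..n}\<close> by auto
      then have "f u = 0" using that by (simp add: supported_def)
      then show ?thesis by (auto simp: substitute_def s_def intro: sum.neutral)
    qed
  qed
  have "eliminates n {} S l S s"
    unfolding eliminates_def using sub by (auto simp: s_def)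
  then show ?case by blast
next
  case (insert j J)
  note sup = insert.prems(2)[OF insertI1]
  consider c where "\<And>u. (\<Sum>i\<in>J. c i * l i u) = (if u = 0 then 1 else 0)"
    | S' s where "eliminates n J S l S' s"
    using insert by blast
  then show ?case
  proof cases
    case (1 c)
    have "(\<Sum>i\<in>insert j J. (c(j := 0)) i * l i u) = (if u = 0 then 1 else 0)" for u
    proof -
      have "(\<Sum>i\<in>J. (c(j := 0)) i * l i u) = (\<Sum>i\<in>J. c i * l i u)"
        using insert.hyps(2) by (intro sum.cong) auto
      then show ?thesis using 1[of u] insert.hyps by simp
    qed
    then show ?thesis by blast
  next
    case (2 S' s)
    then have S': "S' \<subseteq> S" and s0: "\<And>u. s 0 u = (if u = 0 then 1 else 0)"
      and supp: "\<And>f. supported S f \<Longrightarrow> supported S' (substitute n s f)"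
      and rep: "\<And>f. supported S f \<Longrightarrow> \<exists>h. \<forall>u. f u = substitute n s f u + (\<Sum>i\<in>J. h i * l i u)"
      and zero: "\<And>i u. i \<in> J \<Longrightarrow> substitute n s (l i) u = 0"
      and triv: "\<And>i u. S' = S \<Longrightarrow> i \<in> J \<Longrightarrow> l i u = 0"
      unfolding eliminates_def by blast+
    define f where "f = substitute n s (l j)"
    have f_supp: "supported S' f"
      unfolding f_def by (rule supp[OF sup])
    obtain h where h: "\<And>u. l j u = f u + (\<Sum>i\<in>J. h i * l i u)"
      using rep[OF sup] unfolding f_def by blast
    have extend: "(\<Sum>i\<in>insert j J. (if i = j then y else k i) * l i u) = y * l j u + (\<Sum>i\<in>J. k i * l i u)"
      for y k u
    proof -
      have "(\<Sum>i\<in>J. (if i = j then y else k i) * l i u) = (\<Sum>i\<in>J. k i * l i u)"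
        using insert.hyps(2) by (intro sum.cong) auto
      then show ?thesis using insert.hyps by simp
    qed
    consider "\<And>u. f u = 0" | "f 0 \<noteq> 0" "\<And>u. u \<in> S' \<Longrightarrow> f u = 0" | p where "p \<in> S'" "f p \<noteq> 0"
    proof (cases "f 0 = 0 \<and> (\<forall>u\<in>S'. f u = 0)")
      case True
      then have "f u = 0" for u using f_supp unfolding supported_def by (cases "u \<in> insert 0 S'") auto
      then show thesis by (rule that(1))
    next
      case False
      then show thesis using that(2,3) by blast
    qed
    then show ?thesis
    proof cases
      case 1
      have "eliminates n (insert j J) S l S' s"
        unfolding eliminates_def
      proof (intro conjI allI impI)
        fix g assume g: "supported S g"
        show "supported S' (substitute n s g)" by (rule supp[OF g])
        obtain k where k: "\<And>u. g u = substitute n s g u + (\<Sum>i\<in>J. k i * l i u)"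
          using rep[OF g] by blast
        show "\<exists>h. \<forall>u. g u = substitute n s g u + (\<Sum>i\<in>insert j J. h i * l i u)"
          using k extend[of 0 k] by (intro exI[of _ "\<lambda>i. if i = j then 0 else k i"]) simp
      next
        assume "S' = S"
        then show "\<forall>i\<in>insert j J. \<forall>u. l i u = 0"
          using triv h 1 by simp
      qed (use S' s0 zero 1 in \<open>auto simp: f_def\<close>)
      then show ?thesis by blast
    next
      case 2
      have "(\<Sum>i\<in>insert j J. (if i = j then 1 / f 0 else - h i / f 0) * l i u) = (if u = 0 then 1 else 0)" for u
      proof -
        have "(\<Sum>i\<in>J. - h i / f 0 * l i u) = - (\<Sum>i\<in>J. h i * l i u) / f 0"
          by (simp add: sum_negf sum_divide_distrib)
        then have "(\<Sum>i\<in>insert j J. (if i = j then 1 / f 0 else - h i / f 0) * l i u) = f u / f 0"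
          unfolding extend using h[of u] by (simp add: diff_divide_distrib[symmetric] add_divide_distrib)
        then show ?thesis
          using 2 f_supp by (cases "u \<in> S'") (auto simp: supported_def)
      qed
      then show ?thesis
        by (intro disjI1 exI[of _ "\<lambda>i. if i = j then 1 / f 0 else - h i / f 0"] allI)
    next
      case 3
      \<comment> \<open>Solve the reduced form \<open>f\<close> for the variable \<open>p\<close>.\<close>
      define s' where "s' t u = s t u - s t p / f p * f u" for t u
      have p0: "p \<noteq> 0" "p \<in> S" using 3 S' \<open>S \<subseteq> {1..n}\<close> by auto
      have s': "substitute n s' g u = substitute n s g u - substitute n s g p / f p * f u" for g u
        unfolding substitute_def s'_def
        by (simp add: sum_subtractf sum_distrib_left sum_distrib_right sum_divide_distrib algebra_simps)
      have "eliminates n (insert j J) S l (S' - {p}) s'"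
        unfolding eliminates_def
      proof (intro conjI allI impI)
        fix g assume g: "supported S g"
        show "supported (S' - {p}) (substitute n s' g)"
          using supp[OF g] f_supp 3 p0 unfolding supported_def s' by auto
        obtain k where k: "\<And>u. g u = substitute n s g u + (\<Sum>i\<in>J. k i * l i u)"
          using rep[OF g] by blast
        define y where "y = substitute n s g p / f p"
        have "g u = substitute n s' g u + (\<Sum>i\<in>insert j J. (if i = j then y else k i - y * h i) * l i u)" for u
          unfolding extend s' y_def[symmetric]
          using k[of u] h[of u]
          by (simp add: algebra_simps sum_subtractf sum_distrib_left)
        then show "\<exists>h. \<forall>u. g u = substitute n s' g u + (\<Sum>i\<in>insert j J. h i * l i u)"
          by (intro exI[of _ "\<lambda>i. if i = j then y else k i - y * h i"] allI)
      qed (use S' s0 zero 3 p0 s' in \<open>auto simp: f_def s'_def\<close>)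
      then show ?thesis by blast
    qed
  qed
qed

section \<open>Lifting certificates along a substitution\<close>

text \<open>
  If \<open>L\<close> and \<open>L'\<close> agree modulo the polynomials \<open>f\<^sub>j\<close>, a certificate for a principal submatrix of \<open>L'\<close>
  is one for \<open>L\<close> modulo the \<open>f\<^sub>j\<close>. The vectors in the certificate are extended by \<open>0\<close> from \<open>I'\<close>
  to \<open>I\<close>; the cofactor of \<open>f\<^sub>j\<close> collects the values \<open>v\<^sup>T H\<^sub>j v\<close>, whence its degree \<open>2 k\<close>.
\<close>

lemma qmodule_substitute:
  assumes "finite I" "I' \<subseteq> I"
    and L: "\<And>r c. L r c = L' r c + (\<Sum>j\<in>J. H r c j * f j)"
    and H: "\<And>r c j. H r c j \<in> polys_deg_le n 0"
    and q: "q \<in> qmodule n I' L' k"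
  shows "\<exists>g. (\<forall>j. g j \<in> polys_deg_le n (2 * k)) \<and> q + (\<Sum>j\<in>J. f j * g j) \<in> qmodule n I L k"
  using q
proof (induction rule: qmodule.induct)
  case zero
  show ?case
    by (intro exI[of _ "\<lambda>_. 0"]) (simp add: polys_deg_le_0 qmodule.zero)
next
  case (square p q)
  then obtain g where "\<forall>j. g j \<in> polys_deg_le n (2 * k)" "q + (\<Sum>j\<in>J. f j * g j) \<in> qmodule n I L k"
    by blast
  then show ?case
    using qmodule.square[OF square.hyps(1)] by (intro exI[of _ g]) (simp add: add.assoc)
next
  case (qform v q)
  then obtain g where g: "\<forall>j. g j \<in> polys_deg_le n (2 * k)" "q + (\<Sum>j\<in>J. f j * g j) \<in> qmodule n I L k"
    by blast
  define d where "d j = (\<Sum>r\<in>I'. \<Sum>c\<in>I'. v r * v c * H r c j)" for j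
  have d: "d j \<in> polys_deg_le n (2 * k)" for j
    unfolding d_def
    using polys_deg_le_mult[OF polys_deg_le_mult[OF qform.hyps(1) qform.hyps(1)] H]
    by (intro polys_deg_le_sum) (simp add: mult_2)
  define w where "w i = (if i \<in> I' then v i else 0)" for i
  have w: "w i \<in> polys_deg_le n k" for i
    using qform.hyps(1) by (simp add: w_def polys_deg_le_0)
  have "qform I L w = qform I' L v"
  proof -
    have *: "(\<Sum>r\<in>I. w r * F r) = (\<Sum>r\<in>I'. v r * F r)" for F
      using assms(1,2) by (intro sum.mono_neutral_cong_right) (auto simp: w_def)
    show ?thesis
      unfolding bform_def mult.assoc sum_distrib_left[symmetric] by (simp only: *)
  qed
  also have "qform I' L v = qform I' L' v + (\<Sum>r\<in>I'. \<Sum>c\<in>I'. \<Sum>j\<in>J. v r * v c * H r c j * f j)"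
    unfolding bform_def L sum.distrib[symmetric]
    by (intro sum.cong refl) (simp add: distrib_left sum_distrib_left mult_ac)
  also have "(\<Sum>r\<in>I'. \<Sum>c\<in>I'. \<Sum>j\<in>J. v r * v c * H r c j * f j) = (\<Sum>r\<in>I'. \<Sum>j\<in>J. \<Sum>c\<in>I'. v r * v c * H r c j * f j)"
    by (intro sum.cong refl sum.swap)
  also have "\<dots> = (\<Sum>j\<in>J. f j * d j)"
    unfolding d_def sum_distrib_left by (subst sum.swap) (simp add: mult_ac)
  finally have "qform I' L' v + (\<Sum>j\<in>J. f j * d j) = qform I L w" ..
  then have "qform I' L' v + q + (\<Sum>j\<in>J. f j * (d j + g j)) = qform I L w + (q + (\<Sum>j\<in>J. f j * g j))"
    by (simp add: distrib_left sum.distrib algebra_simps)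
  also have "\<dots> \<in> qmodule n I L k"
    using w g(2) by (rule qmodule.qform)
  finally show ?case
    using d g(1) by (intro exI[of _ "\<lambda>j. d j + g j"]) (auto intro: polys_deg_le_add)
qed

text \<open>
  To remove the correction \<open>z = \<Sum>\<^sub>j f\<^sub>j g\<^sub>j\<close> from a certificate modulo the \<open>f\<^sub>j\<close>, write
  \<open>-1 = 2 (-1 + z) + (1 - z)\<^sup>2 - z\<^sup>2\<close>; all three summands lie in the module. The degree \<open>2 k + 1\<close> of \<open>z\<close> is
  the source of the exponential degree bound.
\<close>

lemma qmodule_doubling:
  assumes "finite J"
    and f: "\<And>j. j \<in> J \<Longrightarrow> f j \<in> polys_deg_le n 1"
    and nil: "\<And>j. j \<in> J \<Longrightarrow> - ((f j) ^ 2) \<in> qmodule n I L 1"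
    and g: "\<And>j. g j \<in> polys_deg_le n (2 * k)"
    and cert: "- 1 + (\<Sum>j\<in>J. f j * g j) \<in> qmodule n I L k"
  shows "- 1 \<in> qmodule n I L (2 * k + 1)"
proof -
  define z where "z = (\<Sum>j\<in>J. f j * g j)"
  have fg: "f j * g j \<in> polys_deg_le n (2 * k + 1)" if "j \<in> J" for j
    using polys_deg_le_mult[OF f[OF that] g, of j] by (simp add: add.commute)
  have "- ((f j * g j) ^ 2) \<in> qmodule n I L (2 * k + 1)" if "j \<in> J" for j
    using qmodule_mult_square[OF nil[OF that] g, of j] by (simp add: power_mult_distrib mult_ac add.commute)
  then have "- (z ^ 2) \<in> qmodule n I L (2 * k + 1)"
    unfolding z_def using fg by (intro qmodule_minus_square_sum assms(1))
  moreover have "- 1 + z \<in> qmodule n I L (2 * k + 1)"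
    using cert unfolding z_def by (rule qmodule_mono) simp
  moreover have "(1 - z) ^ 2 \<in> qmodule n I L (2 * k + 1)"
    unfolding z_def using fg by (intro qmodule_square polys_deg_le_diff polys_deg_le_sum polys_deg_le_1)
  ultimately have "(1 - z) ^ 2 + ((- 1 + z) + (- 1 + z)) + - (z ^ 2) \<in> qmodule n I L (2 * k + 1)"
    by (blast intro: qmodule_add)
  also have "(1 - z) ^ 2 + ((- 1 + z) + (- 1 + z)) + - (z ^ 2) = - 1"
    by (simp add: power2_eq_square algebra_simps)
  finally show ?thesis .
qed

section \<open>Infeasible pencils\<close>

text \<open>
  A constant matrix that is not semidefinite takes a negative value.
\<close>

lemma minus_one_in_qmodule_constant:
  assumes const: "\<And>r c t. r \<in> I \<Longrightarrow> c \<in> I \<Longrightarrow> t \<noteq> 0 \<Longrightarrow> a r c t = 0"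
    and infeasible: "\<nexists>x. x 0 = 1 \<and> (\<forall>v. 0 \<le> qform I (\<lambda>r c. \<Sum>t\<le>n. a r c t * x t) v)"
  shows "- 1 \<in> qmodule n I (\<lambda>r c. form n (a r c)) k"
proof -
  define x where "x t = (if t = 0 then 1 else 0 :: real)" for t :: nat
  have "(\<Sum>t\<le>n. a r c t * x t) = a r c 0" for r c
    by (simp add: x_def if_distrib[of "\<lambda>x. _ * x"] cong: if_cong)
  then obtain v where v: "qform I (\<lambda>r c. a r c 0) v < 0"
    using infeasible[simplified, rule_format, of x] by (auto simp: x_def not_le)
  have "qform I (\<lambda>r c. form n (a r c)) (\<lambda>i. pconst (v i)) = pconst (qform I (\<lambda>r c. a r c 0) v)"
    unfolding bform_def pconst_sum pconst_mult
    by (intro sum.cong refl) (simp add: form_constant const)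
  then have "pconst (qform I (\<lambda>r c. a r c 0) v) \<in> qmodule n I (\<lambda>r c. form n (a r c)) k"
    by (metis qmodule_qform pconst_in_polys_deg_le)
  then show ?thesis using v by (rule qmodule_minus_one)
qed

text \<open>
  A nonconstant affine form vanishes somewhere.
\<close>

lemma singleton_pencil_constant:
  assumes sup: "supported S (a i i)" and S: "S \<subseteq> {1..n}"
    and infeasible: "\<nexists>x. x 0 = 1 \<and> (\<forall>v. 0 \<le> qform {i} (\<lambda>r c. \<Sum>t\<le>n. a r c t * x t) v)"
    and "t \<noteq> 0"
  shows "a i i t = 0"
proof (rule ccontr)
  assume nz: "a i i t \<noteq> 0"
  define x where "x s = (if s = 0 then 1 else if s = t then - a i i 0 / a i i t else 0)" for s
  have t: "t \<in> {..n} - {0}"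
    using sup S nz \<open>t \<noteq> 0\<close> unfolding supported_def by (meson DiffI atLeastAtMost_iff atMost_iff insertE singletonD subsetD)
  have "(\<Sum>s\<le>n. a i i s * x s) = a i i 0 + (\<Sum>s\<in>{..n} - {0}. a i i s * x s)"
    by (subst sum.remove[of _ 0]) (auto simp: x_def)
  also have "(\<Sum>s\<in>{..n} - {0}. a i i s * x s) = (\<Sum>s\<in>{..n} - {0}. if s = t then - a i i 0 else 0)"
    using nz by (intro sum.cong) (auto simp: x_def)
  also have "\<dots> = - a i i 0" using t by simp
  finally have "(\<Sum>s\<le>n. a i i s * x s) = 0" by simp
  then have "x 0 = 1 \<and> (\<forall>v. 0 \<le> qform {i} (\<lambda>r c. \<Sum>t\<le>n. a r c t * x t) v)"
    by (simp add: bform_def x_def)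
  with infeasible show False by blast
qed

text \<open>
  If \<open>M v = 0\<close> and \<open>v i \<noteq> 0\<close>, subtracting a multiple of \<open>v\<close> moves any vector into the coordinate
  hyperplane \<open>w i = 0\<close> without changing the value of the form. This is why row \<open>i\<close> of a pencil can be
  deleted wherever the forms \<open>v\<^sup>T L e\<^sub>j\<close> vanish.
\<close>

lemma psd_from_kernel_vector:
  fixes M :: "nat \<Rightarrow> nat \<Rightarrow> real"
  assumes "finite I" "i \<in> I" "v i \<noteq> 0"
    and sym: "\<And>r c. r \<in> I \<Longrightarrow> c \<in> I \<Longrightarrow> M r c = M c r"
    and ker: "\<And>c. c \<in> I \<Longrightarrow> (\<Sum>r\<in>I. v r * M r c) = 0"
    and psd: "\<And>u. 0 \<le> qform (I - {i}) M u"
  shows "0 \<le> qform I M w"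
proof -
  define u where "u j = w j - w i / v i * v j" for j
  have bv: "bform I M v z = 0" for z
    by (simp add: bform_sum_columns ker)
  have "w = (\<lambda>j. w i / v i * v j + 1 * u j)"
    by (simp add: u_def)
  then have "qform I M w = qform I M (\<lambda>j. w i / v i * v j + 1 * u j)" by simp
  also have "\<dots> = qform I M u"
    by (subst qform_combination) (auto simp: sym bv)
  also have "\<dots> = qform (I - {i}) M u"
    using qform_insert[of "I - {i}" i M u] sym assms(1-3) by (simp add: insert_absorb u_def)
  also have "\<dots> \<ge> 0" by (rule psd)
  finally show ?thesis .
qed

text \<open>
  Decompose the matrix \<open>B\<close> of the dual problem as a sum of matrices \<open>v v\<^sup>T\<close>, so that
  \<open>\<Sum> v\<^sup>T L v = - (1 - tr B)\<close>. If the right-hand side is negative, it is a certificate of degree \<open>0\<close>.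
  Otherwise \<open>tr B = 1\<close>, so some \<open>v\<close> is nonzero, and minus its contribution is the sum of the other ones.
\<close>

lemma dual_matrix_dichotomy:
  fixes n :: nat and a :: "nat \<Rightarrow> nat \<Rightarrow> nat \<Rightarrow> real"
  defines "L \<equiv> \<lambda>r c. form n (a r c)"
  assumes I: "finite I"
    and infeasible: "\<nexists>x. x 0 = 1 \<and> (\<forall>v. 0 \<le> qform I (\<lambda>r c. \<Sum>t\<le>n. a r c t * x t) v)"
    and not_in: "- 1 \<notin> qmodule n I L 0"
  obtains v i where "i \<in> I" "v i \<noteq> 0" "- qform I L (\<lambda>r. pconst (v r)) \<in> qmodule n I L 0"
proof -
  obtain B where B: "\<And>r c. B r c = B c r" "\<And>v. 0 \<le> qform I B v" "(\<Sum>r\<in>I. B r r) \<le> 1"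
    and zero: "\<And>t. t \<le> n \<Longrightarrow> (\<Sum>r\<in>I. \<Sum>c\<in>I. B r c * a r c t)
          + (1 - (\<Sum>r\<in>I. B r r)) * (if t = 0 then 1 else 0) = 0"
  proof (rule feasible_or_dual_matrix[OF I, of "{..n}" a])
    fix x assume "x 0 = 1" "\<And>v. 0 \<le> qform I (\<lambda>r c. \<Sum>t\<le>n. a r c t * x t) v"
    then show thesis using infeasible by blast
  qed (auto intro: that)
  define c0 where "c0 = 1 - (\<Sum>r\<in>I. B r r)"
  obtain vs where vs: "\<forall>r\<in>I. \<forall>c\<in>I. B r c = (\<Sum>v\<leftarrow>vs. v r * v c)"
    using psd_sum_of_rank_one[OF I, of B] B by blast
  define Q where "Q v = qform I L (\<lambda>r. pconst (v r))" for v
  have Q_in: "Q v \<in> qmodule n I L 0" for v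
    unfolding Q_def by (intro qmodule_qform pconst_in_polys_deg_le)
  have pconst_list: "pconst (\<Sum>v\<leftarrow>ws. f v) = (\<Sum>v\<leftarrow>ws. pconst (f v))" for ws :: "(nat \<Rightarrow> real) list" and f
    by (induction ws) (auto simp: pconst_add)
  have swap: "(\<Sum>v\<leftarrow>ws. \<Sum>r\<in>I. F v r) = (\<Sum>r\<in>I. \<Sum>v\<leftarrow>ws. F v r)"
    for ws :: "(nat \<Rightarrow> real) list" and F :: "(nat \<Rightarrow> real) \<Rightarrow> nat \<Rightarrow> rpoly"
    by (induction ws) (auto simp: sum.distrib)
  have "(\<Sum>v\<leftarrow>vs. Q v) = (\<Sum>r\<in>I. \<Sum>c\<in>I. pconst (B r c) * L r c)"
    unfolding Q_def bform_def swap
    by (intro sum.cong refl)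
      (simp add: vs pconst_list pconst_mult sum_list_mult_const[symmetric])
  also have "\<dots> = form n (\<lambda>t. \<Sum>r\<in>I. \<Sum>c\<in>I. B r c * a r c t)"
    by (simp add: L_def form_combination form_sum)
  also have "\<dots> = form n (\<lambda>t. - c0 * (if t = 0 then 1 else 0))"
  proof -
    have "(\<Sum>r\<in>I. \<Sum>c\<in>I. B r c * a r c t) = - c0 * (if t = 0 then 1 else 0)" if "t \<le> n" for t
      using zero[OF that] unfolding c0_def by linarith
    then show ?thesis
      unfolding form_def by (intro sum.cong refl) simp
  qed
  also have "\<dots> = pconst (- c0)"
    by (subst form_constant) auto
  finally have total: "(\<Sum>v\<leftarrow>vs. Q v) = pconst (- c0)" .
  have "(\<Sum>v\<leftarrow>vs. Q v) \<in> qmodule n I L 0"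
    by (rule qmodule_sum_list) (auto simp: Q_in)
  then have "c0 = 0"
    using not_in qmodule_minus_one[of "- c0" n I L 0] B(3) total by (force simp: c0_def)
  then have tr: "(\<Sum>r\<in>I. B r r) = 1"
    by (simp add: c0_def)
  have "\<exists>v\<in>set vs. \<exists>i\<in>I. v i \<noteq> 0"
  proof (rule ccontr)
    assume "\<not> ?thesis"
    then have "map (\<lambda>v. v r * v r) vs = map (\<lambda>_. 0) vs" if "r \<in> I" for r
      using that by auto
    then have "B r r = 0" if "r \<in> I" for r
      using that vs by (metis sum_list_0)
    then show False using tr by simp
  qed
  then obtain v i where v: "v \<in> set vs" "i \<in> I" "v i \<noteq> 0" by blast
  then obtain ys zs where split: "vs = ys @ v # zs" by (meson split_list)
  have "- Q v = (\<Sum>v\<leftarrow>ys @ zs. Q v)"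
    using total \<open>c0 = 0\<close> unfolding split by (simp add: add_eq_0_iff algebra_simps)
  also have "\<dots> \<in> qmodule n I L 0"
    by (rule qmodule_sum_list) (auto simp: Q_in)
  finally show ?thesis
    using that v by (simp add: Q_def)
qed

text \<open>
  Induction on the size. A pencil of size \<open>1\<close> or without variables is constant if it is infeasible, and
  then has a certificate of degree \<open>0\<close>. Unless there is such a certificate, take \<open>v\<close> with \<open>- v\<^sup>T L v\<close> in the
  module and an index \<open>i\<close> with \<open>v i \<noteq> 0\<close>. The forms \<open>l j = v\<^sup>T L e\<^sub>j\<close> all satisfy
  \<open>- (l j)\<^sup>2 \<in> M\<close> in degree \<open>1\<close>. If \<open>1\<close> is in their span,
  then \<open>-1\<close> is in the module of degree \<open>1\<close>. If not, eliminate them and delete row \<open>i\<close>. The exponent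
  \<open>min (card I - 1) (card S)\<close> drops by at least one when a variable is eliminated, which pays for doubling
  the degree; when none is, all \<open>l j\<close> are zero and nothing has to be doubled.
\<close>

theorem minus_one_in_qmodule:
  assumes "finite I" "S \<subseteq> {1..n}"
    and "\<And>r c. a r c = a c r" "\<And>r c. supported S (a r c)"
    and "\<nexists>x. x 0 = 1 \<and> (\<forall>v. 0 \<le> qform I (\<lambda>r c. \<Sum>t\<le>n. a r c t * x t) v)"
  shows "- 1 \<in> qmodule n I (\<lambda>r c. form n (a r c)) (2 ^ min (card I - 1) (card S) - 1)"
  using assms
proof (induction "card I" arbitrary: I S a)
  case 0
  then have "I = {}" by simp
  then show ?case using 0(6) by (force simp: bform_def intro: exI[of _ "\<lambda>_. 1"])
next
  case (Suc m)
  note I = \<open>finite I\<close> and S = \<open>S \<subseteq> {1..n}\<close> and sym = Suc.prems(3) and supp = Suc.prems(4)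
    and infeasible = Suc.prems(5)
  define L where "L = (\<lambda>r c. form n (a r c))"
  let ?k = "2 ^ min (card I - 1) (card S) - 1 :: nat"
  have "finite S" using S by (rule finite_subset) simp
  have "- 1 \<in> qmodule n I L ?k"
  proof (cases "- 1 \<in> qmodule n I L 0 \<or> card I = 1 \<or> S = {}")
    case True
    then consider "- 1 \<in> qmodule n I L 0" | i where "I = {i}" | "S = {}"
      by (auto simp: card_1_singleton_iff)
    then show ?thesis
    proof cases
      case 1
      then show ?thesis by (rule qmodule_mono) simp
    next
      case (2 i)
      show ?thesis
        unfolding L_def using singleton_pencil_constant[where a = a and i = i, OF supp S] infeasible
        by (intro minus_one_in_qmodule_constant) (auto simp: 2)
    next
      case 3
      show ?thesis
        unfolding L_def using infeasible supp
        by (intro minus_one_in_qmodule_constant) (auto simp: 3 supported_def)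
    qed
  next
    case False
    then have m: "m \<ge> 1" and "card S \<ge> 1"
      using \<open>Suc m = card I\<close> \<open>finite S\<close> by (auto simp: Suc_le_eq card_gt_0_iff)
    \<comment> \<open>This leaves room for the certificate of degree \<open>1\<close> when \<open>1\<close> is in the span of the \<open>l j\<close>.\<close>
    have k: "1 \<le> ?k"
    proof -
      have "1 \<le> min (card I - 1) (card S)"
        using \<open>Suc m = card I\<close> m \<open>card S \<ge> 1\<close> by simp
      then have "2 ^ 1 \<le> (2::nat) ^ min (card I - 1) (card S)"
        by (intro power_increasing) auto
      then show ?thesis by simp
    qed
    obtain v i where i: "i \<in> I" and vi: "v i \<noteq> 0"
      and neg: "- qform I L (\<lambda>r. pconst (v r)) \<in> qmodule n I L 0"
      using dual_matrix_dichotomy[OF I infeasible] False unfolding L_def by blast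
    define l where "l j t = (\<Sum>r\<in>I. v r * a r j t)" for j t
    have form_l: "form n (l j) = (\<Sum>r\<in>I. pconst (v r) * L r j)" for j
      unfolding l_def L_def by (rule form_combination)
    have nil: "- ((form n (l j)) ^ 2) \<in> qmodule n I L 1" if "j \<in> I" for j
      unfolding form_l
      by (rule qmodule_minus_row_square)
        (use I that neg sym in \<open>auto simp: L_def form_in_polys_deg_le[simplified] pconst_in_polys_deg_le\<close>)
    have l_supp: "supported S (l j)" for j
      using supp by (auto simp: supported_def l_def)
    consider c where "\<And>u. (\<Sum>j\<in>I. c j * l j u) = (if u = 0 then 1 else 0)"
      | S' s where "eliminates n I S l S' s"
      using elimination[OF I S, of l] l_supp by blast
    then show ?thesis
    proof cases
      case (1 c)
      have "form n (\<lambda>t. \<Sum>j\<in>I. c j * l j t) = 1"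
        unfolding 1 by (subst form_constant) auto
      then have one: "(\<Sum>j\<in>I. form n (l j) * pconst (- c j)) = - 1"
        by (simp add: form_combination pconst_uminus sum_negf mult.commute)
      have sq: "- ((form n (l j) * pconst (- c j)) ^ 2) \<in> qmodule n I L 1" if "j \<in> I" for j
        using qmodule_mult_square[OF nil[OF that] pconst_in_polys_deg_le[of "- c j" n 0]]
        by (simp add: power_mult_distrib mult.commute)
      have deg: "form n (l j) * pconst (- c j) \<in> polys_deg_le n 1" for j
        using polys_deg_le_mult[OF form_in_polys_deg_le pconst_in_polys_deg_le[of _ n 0]] by simp
      have "- ((\<Sum>j\<in>I. form n (l j) * pconst (- c j)) ^ 2) \<in> qmodule n I L 1"
        by (rule qmodule_minus_square_sum) (use I deg sq in auto)
      then have "- 1 \<in> qmodule n I L 1"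
        unfolding one by simp
      then show ?thesis using k by (rule qmodule_mono)
    next
      case (2 S' s)
      then have S': "S' \<subseteq> S" and s0: "\<And>u. s 0 u = (if u = 0 then 1 else 0)"
        and supp': "\<And>f. supported S f \<Longrightarrow> supported S' (substitute n s f)"
        and rep: "\<And>f. supported S f \<Longrightarrow> \<exists>h. \<forall>u. f u = substitute n s f u + (\<Sum>j\<in>I. h j * l j u)"
        and zero: "\<And>j u. j \<in> I \<Longrightarrow> substitute n s (l j) u = 0"
        and triv: "\<And>j u. S' = S \<Longrightarrow> j \<in> I \<Longrightarrow> l j u = 0"
        unfolding eliminates_def by blast+
      define I' where "I' = I - {i}"
      define a' where "a' r c = substitute n s (a r c)" for r c
      define k' :: nat where "k' = 2 ^ min (card I' - 1) (card S') - 1"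
      have cardI': "card I' = m" "card I' - 1 = m - 1"
        using \<open>Suc m = card I\<close> i I by (simp_all add: I'_def)
      have "- 1 \<in> qmodule n I' (\<lambda>r c. form n (a' r c)) k'"
        unfolding k'_def
      proof (rule Suc.hyps(1))
        show "\<nexists>x. x 0 = 1 \<and> (\<forall>v. 0 \<le> qform I' (\<lambda>r c. \<Sum>t\<le>n. a' r c t * x t) v)"
        proof
          assume "\<exists>x. x 0 = 1 \<and> (\<forall>v. 0 \<le> qform I' (\<lambda>r c. \<Sum>t\<le>n. a' r c t * x t) v)"
          then obtain x where x: "x 0 = 1"
            and psd: "\<And>v. 0 \<le> qform I' (\<lambda>r c. \<Sum>t\<le>n. a' r c t * x t) v" by blast
          \<comment> \<open>The point of the solution space with free coordinates \<open>x\<close>.\<close>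
          define y where "y t = (\<Sum>u\<le>n. s t u * x u)" for t
          have y0: "y 0 = 1"
            by (simp add: y_def s0 x if_distrib[of "\<lambda>x. x * _"] cong: if_cong)
          have ev: "(\<Sum>t\<le>n. f t * y t) = (\<Sum>t\<le>n. substitute n s f t * x t)" for f
            unfolding y_def eval_substitute ..
          have "0 \<le> qform I (\<lambda>r c. \<Sum>t\<le>n. a r c t * y t) w" for w
          proof (rule psd_from_kernel_vector[where v = v, OF I i vi])
            fix r c assume "c \<in> I"
            have "(\<Sum>r\<in>I. v r * (\<Sum>t\<le>n. a r c t * y t)) = (\<Sum>t\<le>n. l c t * y t)"
              unfolding l_def sum_distrib_left sum_distrib_right
              by (subst sum.swap) (simp add: mult_ac)
            then show "(\<Sum>r\<in>I. v r * (\<Sum>t\<le>n. a r c t * y t)) = 0"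
              using zero[OF \<open>c \<in> I\<close>] by (simp add: ev)
          next
            show "0 \<le> qform (I - {i}) (\<lambda>r c. \<Sum>t\<le>n. a r c t * y t) u" for u
              using psd[of u] unfolding I'_def a'_def ev .
          qed (simp add: sym)
          then show False using infeasible y0 by blast
        qed
      qed (use cardI' I S S' sym supp supp' in \<open>auto simp: I'_def a'_def\<close>)
      note IH = this
      obtain h where h: "\<And>r c u. a r c u = a' r c u + (\<Sum>j\<in>I. h r c j * l j u)"
        using rep[OF supp] unfolding a'_def by metis
      have decomposition: "L r c = form n (a' r c) + (\<Sum>j\<in>I. pconst (h r c j) * form n (l j))" for r c
      proof -
        have "a r c = (\<lambda>u. a' r c u + (\<Sum>j\<in>I. h r c j * l j u))" using h by blast
        then show ?thesis unfolding L_def by (simp only: form_add form_combination)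
      qed
      have "\<exists>g. (\<forall>j. g j \<in> polys_deg_le n (2 * k')) \<and>
          - 1 + (\<Sum>j\<in>I. form n (l j) * g j) \<in> qmodule n I L k'"
        by (rule qmodule_substitute[OF I _ decomposition pconst_in_polys_deg_le IH])
          (simp add: I'_def)
      then obtain g where g: "\<And>j. g j \<in> polys_deg_le n (2 * k')"
        and cert: "- 1 + (\<Sum>j\<in>I. form n (l j) * g j) \<in> qmodule n I L k'"
        by blast
      show ?thesis
      proof (cases "S' = S")
        case True
        have "form n (l j) = 0" if "j \<in> I" for j
          using triv[OF True that] by (simp add: form_def)
        then have "- 1 \<in> qmodule n I L k'" using cert by simp
        moreover have "k' \<le> ?k"
          unfolding k'_def True cardI' using \<open>Suc m = card I\<close>
          by (intro diff_le_mono power_increasing) auto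
        ultimately show ?thesis by (rule qmodule_mono)
      next
        case False
        then have "card S' < card S"
          using S' \<open>finite S\<close> by (intro psubset_card_mono) auto
        then have le: "Suc (min (card I' - 1) (card S')) \<le> min (card I - 1) (card S)"
          using cardI' \<open>Suc m = card I\<close> m by linarith
        have "2 * k' + 1 = 2 ^ Suc (min (card I' - 1) (card S')) - 1"
        proof -
          have "1 \<le> (2::nat) ^ min (card I' - 1) (card S')" by simp
          then show ?thesis unfolding k'_def power_Suc by linarith
        qed
        also have "\<dots> \<le> ?k"
          using le by (intro diff_le_mono power_increasing) auto
        finally have "2 * k' + 1 \<le> ?k" .
        moreover have "- 1 \<in> qmodule n I L (2 * k' + 1)"
          by (rule qmodule_doubling[where J = I and f = "\<lambda>j. form n (l j)" and g = g])
            (use I form_in_polys_deg_le nil g cert in auto)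
        ultimately show ?thesis by (metis qmodule_mono)
      qed
    qed
  qed
  then show ?case unfolding L_def .
qed

section \<open>Polynomial matrices and their evaluation\<close>

lemma peval_supset:
  assumes "finite K" "Poly_Mapping.keys p \<subseteq> K"
  shows "peval x p = (\<Sum>t\<in>K. Poly_Mapping.lookup p t * (\<Prod>i\<in>Poly_Mapping.keys t. (x $ i) ^ Poly_Mapping.lookup t i))"
  unfolding peval_def using assms by (intro sum.mono_neutral_left) (auto simp: in_keys_iff)

lemma peval_add: "peval x (p + q) = peval x p + peval x q"
proof -
  let ?K = "Poly_Mapping.keys p \<union> Poly_Mapping.keys q"
  show ?thesis
    using peval_supset[of ?K p x] peval_supset[of ?K q x] peval_supset[of ?K "p + q" x] keys_add[of p q]
    by (simp add: lookup_add sum.distrib distrib_right)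
qed

lemma peval_sum: "peval x (\<Sum>i\<in>A. f i) = (\<Sum>i\<in>A. peval x (f i))"
  by (induction A rule: infinite_finite_induct) (auto simp: peval_add peval_def[of x 0])

lemma peval_pconst: "peval x (pconst c) = c"
  by (simp add: peval_def pconst_def)

lemma peval_pconst_pvar: "peval x (pconst c * pvar i) = c * x $ i"
  by (simp add: peval_def pconst_def pvar_def mult_single)

lemma peval_form: "peval x (form n f) = f 0 + (\<Sum>t<n. f (Suc t) * x $ t)"
proof -
  have "form n f = pconst (f 0) + (\<Sum>t<n. pconst (f (Suc t)) * pvar t)"
    unfolding form_def lessThan_Suc_atMost[symmetric] sum.lessThan_Suc_shift by simp
  then show ?thesis by (simp add: peval_add peval_sum peval_pconst peval_pconst_pvar)
qed

lemma scalar_prod_mult_mat_vec: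
  assumes "L \<in> carrier_mat m m" "v \<in> carrier_vec m"
  shows "v \<bullet> (L *\<^sub>v v) = qform {..<m} (\<lambda>r c. L $$ (r, c)) (\<lambda>i. v $ i)"
  using assms
  by (simp add: scalar_prod_def bform_def sum_distrib_left atLeast0LessThan mult_ac)

lemma qmodule_subset_truncated:
  assumes "L \<in> carrier_mat m m" "q \<in> qmodule n {..<m} (\<lambda>r c. L $$ (r, c)) k"
  shows "q \<in> truncated_quadratic_module m n k L"
  using assms(2)
proof (induction rule: qmodule.induct)
  case zero
  show ?case
    unfolding truncated_quadratic_module_def by (intro CollectI exI[of _ "[]"]) simp
next
  case (square p q)
  then obtain ps vs where q: "q = (\<Sum>p\<leftarrow>ps. p ^ 2) + (\<Sum>v\<leftarrow>vs. v \<bullet> (L *\<^sub>v v))"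
    "set ps \<subseteq> polys_deg_le n k" "\<forall>v\<in>set vs. v \<in> carrier_vec m \<and> (\<forall>i<m. v $ i \<in> polys_deg_le n k)"
    unfolding truncated_quadratic_module_def by blast
  then show ?case
    using square.hyps unfolding truncated_quadratic_module_def
    by (intro CollectI exI[of _ "p # ps"] exI[of _ vs]) (simp add: add.assoc)
next
  case (qform v q)
  then obtain ps vs where q: "q = (\<Sum>p\<leftarrow>ps. p ^ 2) + (\<Sum>v\<leftarrow>vs. v \<bullet> (L *\<^sub>v v))"
    "set ps \<subseteq> polys_deg_le n k" "\<forall>v\<in>set vs. v \<in> carrier_vec m \<and> (\<forall>i<m. v $ i \<in> polys_deg_le n k)"
    unfolding truncated_quadratic_module_def by blast
  have "qform {..<m} (\<lambda>r c. L $$ (r, c)) v = vec m v \<bullet> (L *\<^sub>v vec m v)"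
    unfolding scalar_prod_mult_mat_vec[OF assms(1) vec_carrier]
    by (simp add: bform_def)
  with q qform.hyps show ?case
    unfolding truncated_quadratic_module_def
    by (intro CollectI exI[of _ ps] exI[of _ "vec m v # vs"]) (simp add: algebra_simps)
qed

theorem corollary2p3p3:
  fixes m n :: nat and L :: "rpoly mat"
  assumes "linear_pencil m n L"
    and "infeasible n L"
  shows "- 1 \<in> truncated_quadratic_module m n (2 ^ min (m - 1) n - 1) L"
proof -
  obtain A :: "nat \<Rightarrow> real mat" where A: "\<And>t. t \<le> n \<Longrightarrow> A t \<in> carrier_mat m m"
      "\<And>t. t \<le> n \<Longrightarrow> transpose_mat (A t) = A t"
    and L: "L = mat m m (\<lambda>(r, c). pconst (A 0 $$ (r, c))
                              + (\<Sum>i<n. pvar i * pconst (A (Suc i) $$ (r, c))))"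
    using assms(1) unfolding linear_pencil_def by blast
  define a where "a r c t = (if r < m \<and> c < m \<and> t \<le> n then A t $$ (r, c) else 0)" for r c t
  have L_carrier: "L \<in> carrier_mat m m"
    by (simp add: L)
  have entry: "L $$ (r, c) = form n (a r c)" if "r < m" "c < m" for r c
    using that unfolding form_def lessThan_Suc_atMost[symmetric] sum.lessThan_Suc_shift
    by (simp add: L a_def mult.commute)
  have A_sym: "A t $$ (r, c) = A t $$ (c, r)" if "t \<le> n" "r < m" "c < m" for t r c
    using A(1)[OF that(1)] that by (subst A(2)[OF that(1), symmetric]) auto
  have sym: "a r c = a c r" for r c
    using A_sym by (auto simp: a_def)
  have supp: "supported {1..n} (a r c)" for r c
    by (auto simp: supported_def a_def)
  have "\<nexists>x. x 0 = 1 \<and> (\<forall>v. 0 \<le> qform {..<m} (\<lambda>r c. \<Sum>t\<le>n. a r c t * x t) v)"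
  proof
    assume "\<exists>x. x 0 = 1 \<and> (\<forall>v. 0 \<le> qform {..<m} (\<lambda>r c. \<Sum>t\<le>n. a r c t * x t) v)"
    then obtain x where x: "x 0 = 1" and pos: "\<And>v. 0 \<le> qform {..<m} (\<lambda>r c. \<Sum>t\<le>n. a r c t * x t) v"
      by blast
    define y where "y = vec n (\<lambda>i. x (Suc i))"
    let ?M = "map_mat (peval y) L"
    have M: "?M $$ (r, c) = (\<Sum>t\<le>n. a r c t * x t)" if "r < m" "c < m" for r c
      using that L_carrier unfolding lessThan_Suc_atMost[symmetric] sum.lessThan_Suc_shift
      by (simp add: entry peval_form x y_def)
    have "transpose_mat ?M = ?M"
      using L_carrier M sym by (intro eq_matI) auto
    moreover have "0 \<le> v \<bullet> (?M *\<^sub>v v)" if "v \<in> carrier_vec m" for v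
    proof -
      have "v \<bullet> (?M *\<^sub>v v) = qform {..<m} (\<lambda>r c. ?M $$ (r, c)) (\<lambda>i. v $ i)"
        using L_carrier that by (intro scalar_prod_mult_mat_vec) auto
      also have "\<dots> = qform {..<m} (\<lambda>r c. \<Sum>t\<le>n. a r c t * x t) (\<lambda>i. v $ i)"
        unfolding bform_def by (intro sum.cong refl) (simp add: M)
      finally show ?thesis using pos by simp
    qed
    ultimately have "psd ?M"
      using L_carrier by (auto simp: psd_def)
    then have "y \<in> spectrahedron n L"
      by (simp add: spectrahedron_def y_def)
    then show False
      using assms(2) by (simp add: infeasible_def)
  qed
  from minus_one_in_qmodule[OF finite_lessThan subset_refl sym supp this]
  have "- 1 \<in> qmodule n {..<m} (\<lambda>r c. form n (a r c)) (2 ^ min (m - 1) n - 1)"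
    by simp
  then have "- 1 \<in> qmodule n {..<m} (\<lambda>r c. L $$ (r, c)) (2 ^ min (m - 1) n - 1)"
    by (rule qmodule_cong) (simp add: entry)
  then show ?thesis
    by (rule qmodule_subset_truncated[OF L_carrier])
qed

end
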